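(* Let $\Pi$ be the feasible set of any one of the three problems (P1), (P2), (P3) defined in the context, and let $\pi_e^*$ be a solution of that problem, i.e. $\pi_e^*\in\arg\min_{\pi_e\in\Pi}\sum_{a\in[K]}\frac{\pi_\Delta(a)^2}{\pi_e(a)}$. Let $\mathcal{I}=\{(\boldsymbol r,\{\sigma_a\}_{a\in[K]}) : 0\le r_a\le 1,\ 0\le\sigma_a\le\sigma \text{ for all } a\in[K]\}$. Then: (1) (Minimax optimality) $$\pi_e^*\in\arg\min_{\pi_e\in\Pi}\ \max_{(\boldsymbol r,\{\sigma_a\})\in\mathcal I}\ \nu(\pi_e;\boldsymbol r,\{\sigma_a\}).$$ (2) (Optimality on average) For every probability distribution $Q$ over instances $(\boldsymbol r,\{\sigma_a\})\in\mathcal I$ such that each of $\mathbb E_Q(r_a)$, $\mathrm{var}_Q(r_a)$ and $\mathbb E_Q(\sigma_a^2)$ takes the same value for all arms $a\in[K]$, $$\pi_e^*\in\arg\min_{\pi_e\in\Pi}\ \mathbb E_{(\boldsymbol r,\{\sigma_a\})\sim Q}\ \nu(\pi_e;\boldsymbol r,\{\sigma_a\}).$$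
   Context: Multi-armed bandit. Let $K,T$ be positive integers, $[K]=\{1,\dots,K\}$, $\sigma>0$, $\epsilon\in(0,1)$, and let $\Delta_{K-1}$ be the set of probability vectors on $[K]$; a policy is an element $\pi\in\Delta_{K-1}$, $\pi(a)$ being the probability of pulling arm $a$. A problem instance is $(\boldsymbol r,\{\sigma_a\})$ with $\boldsymbol r=(r_1,\dots,r_K)\in[0,1]^K$ and $0\le\sigma_a\le\sigma$: pulling arm $a$ yields a random reward with mean $r_a$ and variance $\sigma_a^2$. The value of a policy is $V(\pi)=\sum_a\pi(a)r_a$. Fix a target policy $\pi_1$ and a baseline policy $\pi_0$, and put $\pi_\Delta=\pi_1-\pi_0$. Under an exploration policy $\pi_e$, a dataset $\mathcal D_e=\{(A_t,R_t)\}_{t=1}^T$ of i.i.d. pairs is collected, with $A_t\sim\pi_e$, $\mathbb E[R_t\mid A_t=a]=r_a$, $\mathrm{var}(R_t\mid A_t=a)=\sigma_a^2$. The inverse probability weighting estimator of $V(\pi)$ is $\widehat V_{IPW}(\pi;\mathcal D_e)=\frac1T\sum_{t=1}^T\frac{\pi(A_t)}{\pi_e(A_t)}R_t$. Define $\nu(\pi_e;\boldsymbol r,\{\sigma_a\})=\mathrm{var}\big(\widehat V_{IPW}(\pi_1;\mathcal D_e)-\widehat V_{IPW}(\pi_0;\mathcal D_e)\big)$ when the true parameters are $\boldsymbol r,\{\sigma_a\}$; the difference of the estimators is $\frac1T\sum_{t=1}^T\frac{\pi_\Delta(A_t)}{\pi_e(A_t)}R_t$. Let $\Pi_\Delta=\{\pi\in\Delta_{K-1}:\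 \pi(a)>0 \text{ whenever } \pi_\Delta(a)\neq 0\}$. Convention: in sums $\sum_a\pi_\Delta(a)^2/\pi_e(a)$, a term with $\pi_\Delta(a)=\pi_e(a)=0$ is $0$. The three problems all minimize $\sum_{a\in[K]}\pi_\Delta(a)^2/\pi_e(a)$ over $\pi_e\in\Pi$, where the feasible set $\Pi$ is: (P1) $\Pi=\Pi_\Delta$; (P2) $\Pi=\{\pi_e\in\Pi_\Delta:\ \pi_e(a)\ge(1-\epsilon)\pi_0(a)\ \forall a\in[K]\}$; (P3) $\Pi=\{\pi_e\in\Pi_\Delta:\ \boldsymbol r'^{T}(\pi_e-(1-\epsilon)\pi_0)\ge0\ \forall \boldsymbol r'\in\mathcal C\}$, where $\mathcal C\subset\mathbb R^K$ is a given fixed convex set (a confidence or credible region for the mean reward vector computed from previously available data independent of $\mathcal D_e$). *)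

theory Defs
  imports "HOL-Probability.Probability"
begin

text \<open>
  The arms are the elements of a finite type \<open>'k\<close>, so that \<open>K = CARD('k)\<close>, and vectors
  indexed by the arms are elements of \<open>real ^ 'k\<close>.
\<close>

definition policies :: "(real ^ 'k::finite) set" where
  "policies = {p. (\<forall>a. 0 \<le> p $ a) \<and> (\<Sum>a\<in>UNIV. p $ a) = 1}"

text \<open>A problem instance is a pair of the mean rewards and the reward standard deviations.\<close>

type_synonym 'k bandit = "(real ^ 'k) \<times> (real ^ 'k)"

definition instances :: "real \<Rightarrow> 'k::finite bandit set" where
  "instances \<sigma> = {(r, s). \<forall>a. 0 \<le> r $ a \<and> r $ a \<le> 1 \<and> 0 \<le> s $ a \<and> s $ a \<le> \<sigma>}"

text \<open>
  Under the law \<open>M\<close>, the pairs \<open>(A t, R t)\<close> for \<open>t = 1, \<dots>, T\<close> are an i.i.d. dataset collected with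
  the policy \<open>pe\<close> from the instance \<open>(r, s)\<close>.  Conditioning on \<open>A t = a\<close> is only meaningful for
  arms that are pulled with positive probability; integrability of the squared reward has to be
  required because the Bochner integral of a non-integrable function is 0.
\<close>

definition bandit_data ::
  "'w measure \<Rightarrow> (nat \<Rightarrow> 'w \<Rightarrow> 'k::finite) \<Rightarrow> (nat \<Rightarrow> 'w \<Rightarrow> real) \<Rightarrow> nat \<Rightarrow> real ^ 'k \<Rightarrow> 'k bandit \<Rightarrow> bool"
where
  "bandit_data M A R T pe x \<longleftrightarrow>
     prob_space M \<and>
     prob_space.indep_vars M (\<lambda>_. count_space UNIV \<Otimes>\<^sub>M borel) (\<lambda>t \<omega>. (A t \<omega>, R t \<omega>)) {1..T} \<and>
     (\<forall>t\<in>{1..T}. \<forall>t'\<in>{1..T}.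
        distr M (count_space UNIV \<Otimes>\<^sub>M borel) (\<lambda>\<omega>. (A t \<omega>, R t \<omega>)) =
        distr M (count_space UNIV \<Otimes>\<^sub>M borel) (\<lambda>\<omega>. (A t' \<omega>, R t' \<omega>))) \<and>
     (\<forall>t\<in>{1..T}. \<forall>a. measure M {\<omega> \<in> space M. A t \<omega> = a} = pe $ a) \<and>
     (\<forall>t\<in>{1..T}. \<forall>a. pe $ a > 0 \<longrightarrow>
        (let M\<^sub>a = uniform_measure M {\<omega> \<in> space M. A t \<omega> = a} in
           integrable M\<^sub>a (\<lambda>\<omega>. (R t \<omega>)\<^sup>2) \<and>
           (\<integral>\<omega>. R t \<omega> \<partial>M\<^sub>a) = fst x $ a \<and>
           prob_space.variance M\<^sub>a (R t) = (snd x $ a)\<^sup>2))"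

definition V_IPW ::
  "(nat \<Rightarrow> 'w \<Rightarrow> 'k::finite) \<Rightarrow> (nat \<Rightarrow> 'w \<Rightarrow> real) \<Rightarrow> nat \<Rightarrow> real ^ 'k \<Rightarrow> real ^ 'k \<Rightarrow> 'w \<Rightarrow> real"
where
  "V_IPW A R T pe p \<omega> = (1 / real T) * (\<Sum>t=1..T. p $ (A t \<omega>) / pe $ (A t \<omega>) * R t \<omega>)"

text \<open>
  \<open>P pe x\<close> is the law of the dataset under the exploration policy \<open>pe\<close> when the true parameters
  are \<open>x\<close>; the coordinates \<open>A\<close> and \<open>R\<close> are common to all these laws.
\<close>

definition \<nu> ::
  "(real ^ 'k \<Rightarrow> 'k bandit \<Rightarrow> 'w measure) \<Rightarrow> (nat \<Rightarrow> 'w \<Rightarrow> 'k::finite) \<Rightarrow> (nat \<Rightarrow> 'w \<Rightarrow> real) \<Rightarrow> nat \<Rightarrow>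
   real ^ 'k \<Rightarrow> real ^ 'k \<Rightarrow> real ^ 'k \<Rightarrow> 'k bandit \<Rightarrow> real"
where
  "\<nu> P A R T p1 p0 pe x =
     prob_space.variance (P pe x) (\<lambda>\<omega>. V_IPW A R T pe p1 \<omega> - V_IPW A R T pe p0 \<omega>)"

definition Pi_Delta :: "real ^ 'k::finite \<Rightarrow> real ^ 'k \<Rightarrow> (real ^ 'k) set" where
  "Pi_Delta p1 p0 = {p \<in> policies. \<forall>a. (p1 - p0) $ a \<noteq> 0 \<longrightarrow> p $ a > 0}"

definition feasible1 :: "real ^ 'k::finite \<Rightarrow> real ^ 'k \<Rightarrow> (real ^ 'k) set" where
  "feasible1 p1 p0 = Pi_Delta p1 p0"

definition feasible2 :: "real ^ 'k::finite \<Rightarrow> real ^ 'k \<Rightarrow> real \<Rightarrow> (real ^ 'k) set" where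
  "feasible2 p1 p0 \<epsilon> = {p \<in> Pi_Delta p1 p0. \<forall>a. p $ a \<ge> (1 - \<epsilon>) * p0 $ a}"

definition feasible3 :: "real ^ 'k::finite \<Rightarrow> real ^ 'k \<Rightarrow> real \<Rightarrow> (real ^ 'k) set \<Rightarrow> (real ^ 'k) set" where
  "feasible3 p1 p0 \<epsilon> C = {p \<in> Pi_Delta p1 p0. \<forall>r'\<in>C. r' \<bullet> (p - (1 - \<epsilon>) *\<^sub>R p0) \<ge> 0}"

text \<open>Terms with a zero denominator are 0 because \<open>x / 0 = 0\<close>.\<close>

definition objective :: "real ^ 'k::finite \<Rightarrow> real ^ 'k \<Rightarrow> real ^ 'k \<Rightarrow> real" where
  "objective p1 p0 pe = (\<Sum>a\<in>UNIV. ((p1 - p0) $ a)\<^sup>2 / pe $ a)"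

end

(*
  With d = p1 - p0, the two IPW estimates differ by an average of T i.i.d. terms, so the variance is
    nu = ((\<Sum>a. d a ^ 2 / pe a * (s a ^ 2 + r a ^ 2)) - (\<Sum>a. d a * r a) ^ 2) / T.
  Since \<Sum>a. d a = 0, the subtracted square vanishes at r = 1, s = \<sigma>, where the first sum is also
  largest: the worst case is (\<sigma>^2 + 1) / T times the objective.  Averaging over a prior with equal
  arm moments gives c / T times the objective, with c \<ge> 0, minus a term that does not depend on pe.  Both
  criteria are thus nondecreasing functions of the objective.
*)
theory Submission
  imports Defs
begin

section \<open>Variance of finite sums of independent square-integrable variables\<close>

text \<open>Independence turns the expectation of the product into the product of the expectations,
  so the cross terms of the second moment and of the squared mean cancel. Square integrability of
  the sum is recorded too, since an induction over more summands has to feed it back in.\<close>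

lemma (in prob_space) variance_add_indep:
  fixes X Y :: "'a \<Rightarrow> real"
  assumes indep: "indep_var borel X borel Y"
    and X2: "integrable M (\<lambda>\<omega>. (X \<omega>)\<^sup>2)" and Y2: "integrable M (\<lambda>\<omega>. (Y \<omega>)\<^sup>2)"
  shows "integrable M (\<lambda>\<omega>. (X \<omega> + Y \<omega>)\<^sup>2)"
    and "variance (\<lambda>\<omega>. X \<omega> + Y \<omega>) = variance X + variance Y"
proof -
  have [measurable]: "X \<in> borel_measurable M" "Y \<in> borel_measurable M"
    using indep by (auto dest: indep_var_rv1 indep_var_rv2)
  have X: "integrable M X" and Y: "integrable M Y"
    using X2 Y2 by (auto intro: square_integrable_imp_integrable)
  note XY = indep_var_integrable[OF indep X Y] indep_var_lebesgue_integral[OF indep X Y]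
  have eq: "(\<lambda>\<omega>. (X \<omega> + Y \<omega>)\<^sup>2) = (\<lambda>\<omega>. (X \<omega>)\<^sup>2 + (Y \<omega>)\<^sup>2 + 2 * (X \<omega> * Y \<omega>))"
    by (simp add: fun_eq_iff power2_sum mult.assoc)
  show int: "integrable M (\<lambda>\<omega>. (X \<omega> + Y \<omega>)\<^sup>2)"
    unfolding eq using X2 Y2 XY(1) by simp
  have "expectation (\<lambda>\<omega>. (X \<omega> + Y \<omega>)\<^sup>2)
      = expectation (\<lambda>\<omega>. (X \<omega>)\<^sup>2) + expectation (\<lambda>\<omega>. (Y \<omega>)\<^sup>2) + 2 * (expectation X * expectation Y)"
    unfolding eq using X2 Y2 XY by simp
  then show "variance (\<lambda>\<omega>. X \<omega> + Y \<omega>) = variance X + variance Y"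
    using X Y X2 Y2 int by (subst (1 2 3) variance_eq) (auto simp: power2_sum)
qed

lemma (in prob_space) variance_sum_indep:
  fixes X :: "'i \<Rightarrow> 'a \<Rightarrow> real"
  assumes "finite I" and "indep_vars (\<lambda>_. borel) X I"
    and "\<And>i. i \<in> I \<Longrightarrow> integrable M (\<lambda>\<omega>. (X i \<omega>)\<^sup>2)"
  shows "integrable M (\<lambda>\<omega>. (\<Sum>i\<in>I. X i \<omega>)\<^sup>2) \<and>
    variance (\<lambda>\<omega>. \<Sum>i\<in>I. X i \<omega>) = (\<Sum>i\<in>I. variance (X i))"
  using assms
proof (induction I rule: finite_induct)
  case empty
  then show ?case by simp
next
  case (insert i I)
  have IH: "integrable M (\<lambda>\<omega>. (\<Sum>i\<in>I. X i \<omega>)\<^sup>2)"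
    "variance (\<lambda>\<omega>. \<Sum>i\<in>I. X i \<omega>) = (\<Sum>i\<in>I. variance (X i))"
    using insert.IH insert.prems indep_vars_subset[OF insert.prems(1), of I] by auto
  \<comment> \<open>Joint independence, not merely pairwise, makes \<open>X i\<close> independent of
    the whole partial sum over \<open>I\<close>.\<close>
  note add = variance_add_indep[OF indep_vars_sum[OF insert.hyps insert.prems(1)]
      insert.prems(2)[OF insertI1] IH(1)]
  show ?case
    using add IH(2) insert.hyps by simp
qed

section \<open>From moments conditional on an arm to moments of one weighted reward\<close>

text \<open>Conditioning on \<open>B\<close> amounts to the density
  \<open>indicator B / prob B\<close>. This translates the conditional moments prescribed by
  \<open>bandit_data\<close> into integrals over the unconditioned law, where different arms can be
  added up.\<close>

lemma (in prob_space) uniform_measure_integral: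
  fixes f :: "'a \<Rightarrow> real"
  assumes [measurable]: "B \<in> events" "f \<in> borel_measurable M" and pos: "prob B > 0"
  shows "integrable (uniform_measure M B) f \<longleftrightarrow> integrable M (\<lambda>\<omega>. indicator B \<omega> * f \<omega>)"
    and "(\<integral>\<omega>. indicator B \<omega> * f \<omega> \<partial>M) = prob B * (\<integral>\<omega>. f \<omega> \<partial>uniform_measure M B)"
proof -
  have eq: "uniform_measure M B = density M (\<lambda>\<omega>. ennreal (indicator B \<omega> / prob B))"
    unfolding uniform_measure_def
    by (intro density_cong)
      (auto simp: emeasure_eq_measure divide_ennreal[symmetric] pos split: split_indicator)
  have "integrable M (\<lambda>\<omega>. (1 / prob B) * (indicator B \<omega> * f \<omega>))
      \<longleftrightarrow> integrable M (\<lambda>\<omega>. indicator B \<omega> * f \<omega>)"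
    using pos by (subst integrable_mult_left_iff) auto
  then show "integrable (uniform_measure M B) f \<longleftrightarrow> integrable M (\<lambda>\<omega>. indicator B \<omega> * f \<omega>)"
    unfolding eq by (subst integrable_density) (auto simp: field_simps)
  have "(\<integral>\<omega>. f \<omega> \<partial>uniform_measure M B) = (\<integral>\<omega>. (1 / prob B) * (indicator B \<omega> * f \<omega>) \<partial>M)"
    unfolding eq by (subst integral_density) (auto simp: field_simps)
  then show "(\<integral>\<omega>. indicator B \<omega> * f \<omega> \<partial>M) = prob B * (\<integral>\<omega>. f \<omega> \<partial>uniform_measure M B)"
    using pos by simp
qed

lemma bandit_data_arm_moments:
  assumes data: "bandit_data M A R T pe x" and t: "t \<in> {1..T}" and pos: "pe $ a > 0"
  defines "B \<equiv> {\<omega> \<in> space M. A t \<omega> = a}"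
  shows "integrable M (\<lambda>\<omega>. indicator B \<omega> * R t \<omega>)"
    and "(\<integral>\<omega>. indicator B \<omega> * R t \<omega> \<partial>M) = pe $ a * fst x $ a"
    and "integrable M (\<lambda>\<omega>. indicator B \<omega> * (R t \<omega>)\<^sup>2)"
    and "(\<integral>\<omega>. indicator B \<omega> * (R t \<omega>)\<^sup>2 \<partial>M) = pe $ a * ((snd x $ a)\<^sup>2 + (fst x $ a)\<^sup>2)"
proof -
  interpret prob_space M using data by (simp add: bandit_data_def)
  have "indep_vars (\<lambda>_. count_space UNIV \<Otimes>\<^sub>M borel) (\<lambda>t \<omega>. (A t \<omega>, R t \<omega>)) {1..T}"
    using data by (simp add: bandit_data_def)
  then have AR: "(\<lambda>\<omega>. (A t \<omega>, R t \<omega>)) \<in> M \<rightarrow>\<^sub>M count_space UNIV \<Otimes>\<^sub>M borel"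
    using t by (auto simp: indep_vars_def)
  have [measurable]: "A t \<in> M \<rightarrow>\<^sub>M count_space UNIV" "R t \<in> borel_measurable M"
    using measurable_compose[OF AR measurable_fst] measurable_compose[OF AR measurable_snd] by simp_all
  have B: "B \<in> events" unfolding B_def by measurable
  have pB: "prob B = pe $ a"
    using data t by (simp add: bandit_data_def B_def)
  \<comment> \<open>The conditional law is a probability measure because the arm has positive
    probability. This allows the conditional second moment to be recovered as variance plus squared
    mean.\<close>
  interpret U: prob_space "uniform_measure M B"
    using pos pB by (intro prob_space_uniform_measure) (auto simp: emeasure_eq_measure)
  have "\<forall>t\<in>{1..T}. \<forall>a. pe $ a > 0 \<longrightarrow>
      (let M\<^sub>a = uniform_measure M {\<omega> \<in> space M. A t \<omega> = a} in
        integrable M\<^sub>a (\<lambda>\<omega>. (R t \<omega>)\<^sup>2) \<and> (\<integral>\<omega>. R t \<omega> \<partial>M\<^sub>a) = fst x $ a \<and>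
        prob_space.variance M\<^sub>a (R t) = (snd x $ a)\<^sup>2)"
    using data unfolding bandit_data_def by (elim conjE)
  note cond = this[rule_format, OF t pos, unfolded Let_def, folded B_def]
  have R2: "integrable (uniform_measure M B) (\<lambda>\<omega>. (R t \<omega>)\<^sup>2)"
    and ER: "(\<integral>\<omega>. R t \<omega> \<partial>uniform_measure M B) = fst x $ a"
    and VR: "U.variance (R t) = (snd x $ a)\<^sup>2"
    by (rule cond[THEN conjunct1] cond[THEN conjunct2, THEN conjunct1]
        cond[THEN conjunct2, THEN conjunct2])+
  \<comment> \<open>Only the squared reward is integrable by assumption; on a probability space this
    implies that the reward itself is integrable.\<close>
  have R1: "integrable (uniform_measure M B) (R t)"
    by (rule U.square_integrable_imp_integrable[OF _ R2]) simp
  have ER2: "(\<integral>\<omega>. (R t \<omega>)\<^sup>2 \<partial>uniform_measure M B) = (snd x $ a)\<^sup>2 + (fst x $ a)\<^sup>2"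
    using U.variance_eq[OF R1 R2] ER VR by simp
  show "integrable M (\<lambda>\<omega>. indicator B \<omega> * R t \<omega>)"
    "(\<integral>\<omega>. indicator B \<omega> * R t \<omega> \<partial>M) = pe $ a * fst x $ a"
    "integrable M (\<lambda>\<omega>. indicator B \<omega> * (R t \<omega>)\<^sup>2)"
    "(\<integral>\<omega>. indicator B \<omega> * (R t \<omega>)\<^sup>2 \<partial>M) = pe $ a * ((snd x $ a)\<^sup>2 + (fst x $ a)\<^sup>2)"
    using uniform_measure_integral[OF B, of "R t"] uniform_measure_integral[OF B, of "\<lambda>\<omega>. (R t \<omega>)\<^sup>2"]
      pos pB R1 R2 ER ER2 by simp_all
qed

text \<open>Division by \<open>pe $ a = 0\<close> yields 0 on both sides, the correct contribution since then \<open>w $ a = 0\<close>.\<close>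

lemma weighted_reward_moments:
  fixes w pe :: "real ^ 'k::finite"
  assumes data: "bandit_data M A R T pe x" and t: "t \<in> {1..T}"
    and pe: "\<And>a. 0 \<le> pe $ a" and supp: "\<And>a. w $ a \<noteq> 0 \<Longrightarrow> pe $ a > 0"
  defines "X \<equiv> \<lambda>\<omega>. w $ (A t \<omega>) / pe $ (A t \<omega>) * R t \<omega>"
  shows "integrable M X"
    and "(\<integral>\<omega>. X \<omega> \<partial>M) = (\<Sum>a\<in>UNIV. w $ a * fst x $ a)"
    and "integrable M (\<lambda>\<omega>. (X \<omega>)\<^sup>2)"
    and "(\<integral>\<omega>. (X \<omega>)\<^sup>2 \<partial>M) =
      (\<Sum>a\<in>UNIV. (w $ a)\<^sup>2 / pe $ a * ((snd x $ a)\<^sup>2 + (fst x $ a)\<^sup>2))"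
proof -
  let ?B = "\<lambda>a. {\<omega> \<in> space M. A t \<omega> = a}"
  \<comment> \<open>The events \<open>?B a\<close> partition the space, so at each outcome exactly
    one summand survives. The random weight thereby becomes a deterministic coefficient on each
    event.\<close>
  have split: "g (A t \<omega>) * h \<omega> = (\<Sum>a\<in>UNIV. g a * (indicator (?B a) \<omega> * h \<omega>))"
    if "\<omega> \<in> space M" for g :: "'k \<Rightarrow> real" and h \<omega>
  proof -
    have "(\<Sum>a\<in>UNIV. g a * (indicator (?B a) \<omega> * h \<omega>)) = (\<Sum>a\<in>UNIV. if a = A t \<omega> then g a * h \<omega> else 0)"
      using that by (intro sum.cong) (auto split: split_indicator)
    then show ?thesis by simp
  qed
  have sX: "X \<omega> = (\<Sum>a\<in>UNIV. w $ a / pe $ a * (indicator (?B a) \<omega> * R t \<omega>))"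
    if "\<omega> \<in> space M" for \<omega>
    using split[OF that, of "\<lambda>a. w $ a / pe $ a"] by (simp add: X_def)
  have sX2: "(X \<omega>)\<^sup>2 = (\<Sum>a\<in>UNIV. (w $ a / pe $ a)\<^sup>2 * (indicator (?B a) \<omega> * (R t \<omega>)\<^sup>2))"
    if "\<omega> \<in> space M" for \<omega>
    using split[OF that, of "\<lambda>a. (w $ a / pe $ a)\<^sup>2" "\<lambda>\<omega>. (R t \<omega>)\<^sup>2"]
    unfolding X_def power_mult_distrib .
  \<comment> \<open>If \<open>pe $ a > 0\<close>, the probability \<open>pe $ a\<close> of the event
    cancels one factor of the denominator: completely in the mean, which is why that is free of
    \<open>pe\<close>, and down to a single \<open>pe $ a\<close> in the second moment.\<close>
  have i1: "integrable M (\<lambda>\<omega>. w $ a / pe $ a * (indicator (?B a) \<omega> * R t \<omega>))"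
    and i2: "integrable M (\<lambda>\<omega>. (w $ a / pe $ a)\<^sup>2 * (indicator (?B a) \<omega> * (R t \<omega>)\<^sup>2))"
    and e1: "(\<integral>\<omega>. w $ a / pe $ a * (indicator (?B a) \<omega> * R t \<omega>) \<partial>M) = w $ a * fst x $ a"
    and e2: "(\<integral>\<omega>. (w $ a / pe $ a)\<^sup>2 * (indicator (?B a) \<omega> * (R t \<omega>)\<^sup>2) \<partial>M)
      = (w $ a)\<^sup>2 / pe $ a * ((snd x $ a)\<^sup>2 + (fst x $ a)\<^sup>2)" for a
    using bandit_data_arm_moments[OF data t, of a] supp[of a] pe[of a]
    by (cases "pe $ a = 0"; force simp: power2_eq_square)+
  show "integrable M X"
    using i1 by (subst Bochner_Integration.integrable_cong[OF refl sX]) auto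
  show "(\<integral>\<omega>. X \<omega> \<partial>M) = (\<Sum>a\<in>UNIV. w $ a * fst x $ a)"
    using i1 e1 by (subst Bochner_Integration.integral_cong[OF refl sX])
      (auto simp: Bochner_Integration.integral_sum simp del: integral_mult_right_zero integrable_mult_right_iff)
  show "integrable M (\<lambda>\<omega>. (X \<omega>)\<^sup>2)"
    using i2 by (subst Bochner_Integration.integrable_cong[OF refl sX2]) auto
  show "(\<integral>\<omega>. (X \<omega>)\<^sup>2 \<partial>M) =
      (\<Sum>a\<in>UNIV. (w $ a)\<^sup>2 / pe $ a * ((snd x $ a)\<^sup>2 + (fst x $ a)\<^sup>2))"
    using i2 e2 by (subst Bochner_Integration.integral_cong[OF refl sX2])
      (auto simp: Bochner_Integration.integral_sum simp del: integral_mult_right_zero)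
qed

section \<open>Closed form of the variance \<open>\<nu>\<close>\<close>

lemma variance_weighted_average:
  fixes w pe :: "real ^ 'k::finite"
  assumes data: "bandit_data M A R T pe x" and "T > 0"
    and pe: "\<And>a. 0 \<le> pe $ a" and supp: "\<And>a. w $ a \<noteq> 0 \<Longrightarrow> pe $ a > 0"
  shows "prob_space.variance M (\<lambda>\<omega>. (1 / real T) * (\<Sum>t=1..T. w $ (A t \<omega>) / pe $ (A t \<omega>) * R t \<omega>)) =
    ((\<Sum>a\<in>UNIV. (w $ a)\<^sup>2 / pe $ a * ((snd x $ a)\<^sup>2 + (fst x $ a)\<^sup>2))
      - (\<Sum>a\<in>UNIV. w $ a * fst x $ a)\<^sup>2) / real T"
    (is "_ = ?v / _")
proof -
  interpret prob_space M using data by (simp add: bandit_data_def)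
  define X where "X t = (\<lambda>\<omega>. w $ (A t \<omega>) / pe $ (A t \<omega>) * R t \<omega>)" for t
  have mom: "integrable M (X t)" "expectation (X t) = (\<Sum>a\<in>UNIV. w $ a * fst x $ a)"
    "integrable M (\<lambda>\<omega>. (X t \<omega>)\<^sup>2)"
    "expectation (\<lambda>\<omega>. (X t \<omega>)\<^sup>2) =
      (\<Sum>a\<in>UNIV. (w $ a)\<^sup>2 / pe $ a * ((snd x $ a)\<^sup>2 + (fst x $ a)\<^sup>2))"
    if "t \<in> {1..T}" for t
    unfolding X_def by (rule weighted_reward_moments[OF data that pe supp]; assumption)+
  have AR: "indep_vars (\<lambda>_. count_space UNIV \<Otimes>\<^sub>M borel) (\<lambda>t \<omega>. (A t \<omega>, R t \<omega>)) {1..T}"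
    using data by (simp add: bandit_data_def)
  have meas: "(\<lambda>(a, r). w $ a / pe $ a * r) \<in> borel_measurable (count_space UNIV \<Otimes>\<^sub>M borel)"
    by measurable
  \<comment> \<open>Each \<open>X t\<close> is one fixed measurable function of the pair
    \<open>(A t, R t)\<close>, so independence of the pairs is inherited.\<close>
  have indep: "indep_vars (\<lambda>_. borel) X {1..T}"
    using indep_vars_compose2[OF AR meas] by (simp add: X_def[abs_def])
  have "variance (X t) = ?v" if "t \<in> {1..T}" for t
    using variance_eq[OF mom(1)[OF that] mom(3)[OF that]] mom(2,4)[OF that] by simp
  then have var: "variance (\<lambda>\<omega>. \<Sum>t=1..T. X t \<omega>) = real T * ?v"
    using variance_sum_indep[OF _ indep] mom(3) by simp
  \<comment> \<open>Scaling contributes \<open>1 / T\<close> squared and the \<open>T\<close> equal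
    variances contribute \<open>T\<close>, leaving one factor \<open>1 / T\<close>.\<close>
  have "variance (\<lambda>\<omega>. (1 / real T) * (\<Sum>t=1..T. X t \<omega>))
      = (1 / real T)\<^sup>2 * variance (\<lambda>\<omega>. \<Sum>t=1..T. X t \<omega>)"
    by (simp add: right_diff_distrib[symmetric] power_mult_distrib
        del: integral_divide_zero flip: times_divide_eq_left)
  with var \<open>T > 0\<close> show ?thesis
    by (simp add: X_def power2_eq_square)
qed

text \<open>The IPW estimator is linear in the evaluated policy, so the difference is again a
  weighted average, with weights \<open>p1 - p0\<close>. Membership in \<open>Pi_Delta\<close>
  supplies exactly the support condition on these weights.\<close>

lemma \<nu>_eq:
  fixes p1 p0 pe :: "real ^ 'k::finite"
  assumes "bandit_data (P pe x) A R T pe x" and "T > 0" and pe: "pe \<in> Pi_Delta p1 p0"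
  shows "\<nu> P A R T p1 p0 pe x =
    ((\<Sum>a\<in>UNIV. ((p1 - p0) $ a)\<^sup>2 / pe $ a * ((snd x $ a)\<^sup>2 + (fst x $ a)\<^sup>2))
      - (\<Sum>a\<in>UNIV. (p1 - p0) $ a * fst x $ a)\<^sup>2) / real T"
proof -
  have diff: "V_IPW A R T pe p1 \<omega> - V_IPW A R T pe p0 \<omega> =
      (1 / real T) * (\<Sum>t=1..T. (p1 - p0) $ (A t \<omega>) / pe $ (A t \<omega>) * R t \<omega>)" for \<omega>
    unfolding V_IPW_def right_diff_distrib[symmetric] sum_subtractf[symmetric]
    by (simp add: diff_divide_distrib left_diff_distrib)
  show ?thesis
    unfolding \<nu>_def diff
    by (rule variance_weighted_average) (use assms in \<open>auto simp: Pi_Delta_def policies_def\<close>)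
qed

section \<open>Integrability under a prior on the instances\<close>

text \<open>Every integrand is continuous, hence measurable for the trace of the Borel sets, and
  bounded on \<open>instances \<sigma>\<close>, which is the whole space of
  \<open>Q\<close>.\<close>

lemma instances_prior_moments:
  fixes Q :: "'k::finite bandit measure"
  assumes Q: "prob_space Q" and sets: "sets Q = sets (restrict_space borel (instances \<sigma>))"
  shows "integrable Q (\<lambda>x. fst x $ a)" and "integrable Q (\<lambda>x. (fst x $ a)\<^sup>2)"
    and "integrable Q (\<lambda>x. (snd x $ a)\<^sup>2)" and "integrable Q (\<lambda>x. (\<Sum>a\<in>UNIV. w $ a * fst x $ a)\<^sup>2)"
proof -
  interpret prob_space Q by fact
  have sp: "space Q = instances \<sigma>"
    using sets_eq_imp_space_eq[OF sets] by (simp add: space_restrict_space)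
  have m: "f \<in> borel_measurable Q" if "continuous_on UNIV f" for f :: "'k bandit \<Rightarrow> real"
    using measurable_restrict_space1[OF borel_measurable_continuous_onI[OF that]]
      measurable_cong_sets[OF sets refl] by blast
  have in_inst: "0 \<le> fst x $ a" "fst x $ a \<le> 1" "0 \<le> snd x $ a" "snd x $ a \<le> \<sigma>"
    if "x \<in> space Q" for x a
    using that by (auto simp: sp instances_def)
  show "integrable Q (\<lambda>x. fst x $ a)"
    by (rule integrable_const_bound[where B = 1])
      (auto intro!: AE_I2 m continuous_intros simp: in_inst)
  show "integrable Q (\<lambda>x. (fst x $ a)\<^sup>2)"
    by (rule integrable_const_bound[where B = 1])
      (auto intro!: AE_I2 m continuous_intros simp: in_inst power_le_one)
  show "integrable Q (\<lambda>x. (snd x $ a)\<^sup>2)"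
    by (rule integrable_const_bound[where B = "\<sigma>\<^sup>2"])
      (intro AE_I2, simp add: in_inst power_mono, intro m continuous_intros)
  have bound: "\<bar>\<Sum>a\<in>UNIV. w $ a * fst x $ a\<bar> \<le> (\<Sum>a\<in>UNIV. \<bar>w $ a\<bar>)" if "x \<in> space Q" for x
    by (rule order.trans[OF sum_abs], rule sum_mono)
      (use in_inst[OF that] in \<open>simp add: abs_mult mult_left_le\<close>)
  have "(\<Sum>a\<in>UNIV. w $ a * fst x $ a)\<^sup>2 \<le> (\<Sum>a\<in>UNIV. \<bar>w $ a\<bar>)\<^sup>2" if "x \<in> space Q" for x
    by (rule abs_le_square_iff[THEN iffD1, OF order.trans[OF bound[OF that] abs_ge_self]])
  then show "integrable Q (\<lambda>x. (\<Sum>a\<in>UNIV. w $ a * fst x $ a)\<^sup>2)"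
    by (intro integrable_const_bound[where B = "(\<Sum>a\<in>UNIV. \<bar>w $ a\<bar>)\<^sup>2"])
      (auto intro!: AE_I2 m continuous_intros)
qed

section \<open>Minimax optimality and optimality on average\<close>

theorem theorem1:
  fixes T :: nat and \<sigma> \<epsilon> :: real
    and p1 p0 ps :: "real ^ 'k::finite"
    and C F :: "(real ^ 'k) set"
    and P :: "real ^ 'k \<Rightarrow> 'k bandit \<Rightarrow> 'w measure"
    and A :: "nat \<Rightarrow> 'w \<Rightarrow> 'k" and R :: "nat \<Rightarrow> 'w \<Rightarrow> real"
  assumes "T > 0" and "\<sigma> > 0" and "0 < \<epsilon>" and "\<epsilon> < 1"
    and "p1 \<in> policies" and "p0 \<in> policies"
    and "convex C"
    and "F = feasible1 p1 p0 \<or> F = feasible2 p1 p0 \<epsilon> \<or> F = feasible3 p1 p0 \<epsilon> C"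
    and "\<And>pe x. pe \<in> F \<Longrightarrow> x \<in> instances \<sigma> \<Longrightarrow> bandit_data (P pe x) A R T pe x"
    and "is_arg_min (objective p1 p0) (\<lambda>pe. pe \<in> F) ps"
  shows
      "(\<forall>pe\<in>F. \<exists>x\<in>instances \<sigma>. \<forall>y\<in>instances \<sigma>. \<nu> P A R T p1 p0 pe y \<le> \<nu> P A R T p1 p0 pe x) \<and>
       is_arg_min (\<lambda>pe. SUP x\<in>instances \<sigma>. \<nu> P A R T p1 p0 pe x) (\<lambda>pe. pe \<in> F) ps \<and>
       (\<forall>Q :: 'k bandit measure.
         prob_space Q \<and> sets Q = sets (restrict_space borel (instances \<sigma>)) \<and>
         (\<forall>a b. (\<integral>x. fst x $ a \<partial>Q) = (\<integral>x. fst x $ b \<partial>Q)) \<and>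
         (\<forall>a b. prob_space.variance Q (\<lambda>x. fst x $ a) = prob_space.variance Q (\<lambda>x. fst x $ b)) \<and>
         (\<forall>a b. (\<integral>x. (snd x $ a)\<^sup>2 \<partial>Q) = (\<integral>x. (snd x $ b)\<^sup>2 \<partial>Q)) \<longrightarrow>
         (\<forall>pe\<in>F. integrable Q (\<nu> P A R T p1 p0 pe)) \<and>
         is_arg_min (\<lambda>pe. \<integral>x. \<nu> P A R T p1 p0 pe x \<partial>Q) (\<lambda>pe. pe \<in> F) ps)"
proof -
  define d where "d = p1 - p0"
  have F: "F \<subseteq> Pi_Delta p1 p0"
    using assms(8) by (auto simp: feasible1_def feasible2_def feasible3_def)
  have obj_le: "objective p1 p0 ps \<le> objective p1 p0 pe" if "pe \<in> F" for pe
    using assms(10) that by (auto simp: is_arg_min_linorder)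
  have ps: "ps \<in> F"
    using assms(10) by (simp add: is_arg_min_linorder)
  have d0: "(\<Sum>a\<in>UNIV. d $ a) = 0"
    using assms(5,6) by (simp add: d_def policies_def sum_subtractf)
  have nonneg: "0 \<le> (d $ a)\<^sup>2 / pe $ a" if "pe \<in> F" for pe a
    using F that by (auto simp: Pi_Delta_def policies_def)
  have obj: "objective p1 p0 pe = (\<Sum>a\<in>UNIV. (d $ a)\<^sup>2 / pe $ a)" for pe
    by (simp add: objective_def d_def)
  have nu: "\<nu> P A R T p1 p0 pe x =
      ((\<Sum>a\<in>UNIV. (d $ a)\<^sup>2 / pe $ a * ((snd x $ a)\<^sup>2 + (fst x $ a)\<^sup>2))
        - (\<Sum>a\<in>UNIV. d $ a * fst x $ a)\<^sup>2) / real T" if "pe \<in> F" "x \<in> instances \<sigma>" for pe x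
    unfolding d_def by (rule \<nu>_eq) (use assms(1,9) F that in auto)
  define top :: "'k bandit" where "top = (\<chi> a. 1, \<chi> a. \<sigma>)"
  have top: "top \<in> instances \<sigma>"
    using assms(2) by (simp add: top_def instances_def)
  have nu_top: "\<nu> P A R T p1 p0 pe top = objective p1 p0 pe * (\<sigma>\<^sup>2 + 1) / real T" if "pe \<in> F" for pe
    using nu[OF that top] d0 by (simp add: top_def obj sum_distrib_right)
  have nu_le: "\<nu> P A R T p1 p0 pe x \<le> \<nu> P A R T p1 p0 pe top"
    if "pe \<in> F" "x \<in> instances \<sigma>" for pe x
  proof -
    have "(snd x $ a)\<^sup>2 + (fst x $ a)\<^sup>2 \<le> \<sigma>\<^sup>2 + 1" for a
      using that(2) by (intro add_mono power_mono power_le_one) (auto simp: instances_def)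
    then have "(\<Sum>a\<in>UNIV. (d $ a)\<^sup>2 / pe $ a * ((snd x $ a)\<^sup>2 + (fst x $ a)\<^sup>2))
        \<le> (\<Sum>a\<in>UNIV. (d $ a)\<^sup>2 / pe $ a * (\<sigma>\<^sup>2 + 1))"
      by (intro sum_mono mult_left_mono nonneg that(1))
    \<comment> \<open>At \<open>top\<close> nothing is subtracted, whereas at \<open>x\<close> a
      nonnegative square is; discarding it only enlarges the left side.\<close>
    then show ?thesis
      unfolding nu[OF that] nu_top[OF that(1)] obj sum_distrib_right
      by (intro divide_right_mono diff_left_mono) (auto intro: order.trans[rotated])
  qed
  \<comment> \<open>A real supremum is meaningful only for a bounded nonempty set; here it is a
    maximum, attained at \<open>top\<close>.\<close>
  have Sup: "(SUP x\<in>instances \<sigma>. \<nu> P A R T p1 p0 pe x) = objective p1 p0 pe * (\<sigma>\<^sup>2 + 1) / real T"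
    if "pe \<in> F" for pe
    unfolding nu_top[OF that, symmetric]
    by (rule cSup_eq_maximum) (use top nu_le that in auto)
  have avg: "(\<forall>pe\<in>F. integrable Q (\<nu> P A R T p1 p0 pe)) \<and>
      is_arg_min (\<lambda>pe. \<integral>x. \<nu> P A R T p1 p0 pe x \<partial>Q) (\<lambda>pe. pe \<in> F) ps"
    if Q: "prob_space Q" and sets: "sets Q = sets (restrict_space borel (instances \<sigma>))"
      and mean: "\<And>a b. (\<integral>x. fst x $ a \<partial>Q) = (\<integral>x. fst x $ b \<partial>Q)"
      and var: "\<And>a b. prob_space.variance Q (\<lambda>x. fst x $ a) = prob_space.variance Q (\<lambda>x. fst x $ b)"
      and noise: "\<And>a b. (\<integral>x. (snd x $ a)\<^sup>2 \<partial>Q) = (\<integral>x. (snd x $ b)\<^sup>2 \<partial>Q)"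
    for Q :: "'k bandit measure"
  proof -
    interpret prob_space Q by fact
    have sp: "space Q = instances \<sigma>"
      using sets_eq_imp_space_eq[OF sets] by (simp add: space_restrict_space)
    note int = instances_prior_moments[OF Q sets]
    define m where "m a = (\<integral>x. (snd x $ a)\<^sup>2 \<partial>Q) + (\<integral>x. (fst x $ a)\<^sup>2 \<partial>Q)" for a
    \<comment> \<open>An arbitrary reference arm. Equal means and variances force equal second
      moments of \<open>r\<close>, so \<open>m\<close> takes the value \<open>m b\<close> at every
      arm.\<close>
    obtain b :: 'k where True by simp
    define v where "v = m b"
    have m: "m a = v" for a
      using var[of a b, unfolded variance_eq[OF int(1,2)]] noise[of a b]
      unfolding v_def m_def mean[of a b] by linarith
    have v0: "0 \<le> v" unfolding v_def m_def by simp
    \<comment> \<open>Correlations between the mean rewards of different arms enter only through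
      this constant.\<close>
    define c where "c = (\<integral>x. (\<Sum>a\<in>UNIV. d $ a * fst x $ a)\<^sup>2 \<partial>Q)"
    \<comment> \<open>Nothing is assumed about how the laws \<open>P pe x\<close> vary with
      \<open>x\<close>, so measurability of \<open>\<nu>\<close> in the instance is not immediate.
      It is obtained from this explicit function, with which \<open>\<nu>\<close> agrees on the
      space of \<open>Q\<close> when \<open>pe\<close> is feasible.\<close>
    let ?g = "\<lambda>pe x. ((\<Sum>a\<in>UNIV. (d $ a)\<^sup>2 / pe $ a * ((snd x $ a)\<^sup>2 + (fst x $ a)\<^sup>2))
        - (\<Sum>a\<in>UNIV. d $ a * fst x $ a)\<^sup>2) / real T"
    have g: "integrable Q (?g pe)" for pe
      by (intro integrable_divide Bochner_Integration.integrable_diff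
          Bochner_Integration.integrable_sum integrable_mult_right Bochner_Integration.integrable_add int)
    have "(\<integral>x. ?g pe x \<partial>Q) = ((\<Sum>a\<in>UNIV. (d $ a)\<^sup>2 / pe $ a * m a) - c) / real T" for pe
      unfolding m_def c_def using int
      by (simp add: Bochner_Integration.integral_diff Bochner_Integration.integral_sum)
    then have Eg: "(\<integral>x. ?g pe x \<partial>Q) = (objective p1 p0 pe * v - c) / real T" for pe
      by (simp add: obj sum_distrib_right m)
    have inu: "integrable Q (\<nu> P A R T p1 p0 pe)" if "pe \<in> F" for pe
      using g[of pe] by (subst Bochner_Integration.integrable_cong[OF refl nu[OF that]]) (auto simp: sp)
    have Enu: "(\<integral>x. \<nu> P A R T p1 p0 pe x \<partial>Q) = (objective p1 p0 pe * v - c) / real T"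
      if "pe \<in> F" for pe
      using Eg[of pe] by (subst Bochner_Integration.integral_cong[OF refl nu[OF that]]) (auto simp: sp)
    have "(\<integral>x. \<nu> P A R T p1 p0 ps x \<partial>Q) \<le> (\<integral>x. \<nu> P A R T p1 p0 pe x \<partial>Q)" if "pe \<in> F" for pe
      unfolding Enu[OF that] Enu[OF ps]
      by (intro divide_right_mono diff_right_mono mult_right_mono obj_le that v0) simp
    then show ?thesis
      using inu ps by (simp add: is_arg_min_linorder)
  qed
  have "(SUP x\<in>instances \<sigma>. \<nu> P A R T p1 p0 ps x) \<le> (SUP x\<in>instances \<sigma>. \<nu> P A R T p1 p0 pe x)"
    if "pe \<in> F" for pe
    unfolding Sup[OF that] Sup[OF ps]
    by (intro divide_right_mono mult_right_mono obj_le that) simp_all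
  then have "is_arg_min (\<lambda>pe. SUP x\<in>instances \<sigma>. \<nu> P A R T p1 p0 pe x) (\<lambda>pe. pe \<in> F) ps"
    using ps by (simp add: is_arg_min_linorder)
  with avg top nu_le show ?thesis
    by blast
qed

end
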